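(* Let $f:\mathbb{T}\to[0,1]$ be a Borel function with $\sigma:=\int_{\mathbb{T}} f\,d\mathfrak{m}\in(0,1)$, and let $(\xi_n)_{n\in\mathbb{Z}}$ be the $\{0,1\}$-valued random field of the determinantal point process on $\mathbb{Z}$ induced by the kernel $K_f(n,m)=\widehat{f}(n-m)$. For any positive integer $N$, any $\lambda\in\mathbb{R}$ and any $a=(a_0,\dots,a_{N-1})\in\mathbb{R}^N$, $$\mathbb{E}\left[\exp\left(\lambda\sum_{n=0}^{N-1}(\xi_n-\sigma)a_n\right)\right]\le\exp\left(\lambda^2\sum_{n=0}^{N-1}a_n^2\right).$$
   Context: $\mathbb{T}=\mathbb{R}/\mathbb{Z}$ with normalized Lebesgue measure $\mathfrak{m}$; $\widehat{f}(n)=\int_{\mathbb{T}} f(t)e^{-2\pi i n t}\,d\mathfrak{m}(t)$. The (stationary) determinantal point process induced by $K_f$ is the random subset $\mathfrak{X}=\mathfrak{X}(\omega)$ of $\mathbb{Z}$, defined on a probability space $(\Omega,\mathcal{A},\mathbb{P})$, whose indicator random variables $\xi_n(\omega)=1$ if $n\in\mathfrak{X}(\omega)$ and $\xi_n(\omega)=0$ otherwise satisfy, for all distinct $n_1,\dots,n_k\in\mathbb{Z}$, $\mathbb{E}(\xi_{n_1}\cdots\xi_{n_k})=\det(\widehat{f}(n_i-n_j))_{1\le i,j\le k}$. Such a process exists and its law is uniquely determined by $f$. *)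

theory Defs
  imports "HOL-Probability.Probability" "Jordan_Normal_Form.Determinant"
begin

text \<open>
  A function on the circle \<open>\<real>/\<int>\<close> is represented by a 1-periodic function on the reals, and its
  integral against the normalized Lebesgue measure by the integral over the fundamental
  domain \<open>[0, 1)\<close>.
\<close>

definition circle_integral ::
    "(real \<Rightarrow> 'b) \<Rightarrow> 'b :: {banach, second_countable_topology}" where
  "circle_integral f = (LINT t:{0..<1}|lborel. f t)"

definition fourier_coeff :: "(real \<Rightarrow> real) \<Rightarrow> int \<Rightarrow> complex" where
  "fourier_coeff f n =
     circle_integral (\<lambda>t. complex_of_real (f t) * exp (- 2 * of_real pi * \<i> * of_int n * of_real t))"

definition toeplitz_kernel :: "(real \<Rightarrow> real) \<Rightarrow> int \<Rightarrow> int \<Rightarrow> complex" where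
  "toeplitz_kernel f n m = fourier_coeff f (n - m)"

definition occupation :: "('a \<Rightarrow> int set) \<Rightarrow> int \<Rightarrow> 'a \<Rightarrow> real" where
  "occupation X n \<omega> = indicator (X \<omega>) n"

text \<open>
  Distinct points \<open>n\<^sub>1, \<dots>, n\<^sub>k\<close> are given as a distinct list. The determinant is that of the
  Jordan-Normal-Form library, because the size \<open>k\<close> is quantified.
\<close>

definition determinantal_process ::
    "'a measure \<Rightarrow> (int \<Rightarrow> int \<Rightarrow> complex) \<Rightarrow> ('a \<Rightarrow> int set) \<Rightarrow> bool" where
  "determinantal_process M K X \<longleftrightarrow>
     prob_space M \<and>
     (\<forall>n. occupation X n \<in> borel_measurable M) \<and>
     (\<forall>ns. distinct ns \<longrightarrow>
        complex_of_real (LINT \<omega>|M. (\<Prod>i<length ns. occupation X (ns ! i) \<omega>)) =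
        Determinant.det (Matrix.mat (length ns) (length ns) (\<lambda>(i, j). K (ns ! i) (ns ! j))))"

end

theory Submission imports Defs
begin

text \<open>
  Expanding the product, \<open>E \<Prod>\<^sub>i (1 + b\<^sub>i \<xi>\<^sub>i) = det (I + BK)\<close> with \<open>B = diag b\<close>. If all \<open>b\<^sub>i\<close> are
  nonnegative, or all lie in \<open>(-1, 0]\<close>, then \<open>det (I + BK) = det (I \<plusminus> SKS)\<close> for
  \<open>S = diag (sqrt \<bar>b\<^sub>i\<bar>)\<close>, and \<open>I \<plusminus> SKS\<close> is positive definite because \<open>0 \<le> K \<le> I\<close>. Hadamard's
  inequality therefore bounds the determinant by the product \<open>\<Prod>\<^sub>i (1 + b\<^sub>i \<sigma>)\<close> of the diagonal.
  For \<open>b\<^sub>i = exp y\<^sub>i - 1\<close> this product is the exponential moment of independent Bernoulli variables,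
  which Hoeffding's lemma controls after centring by \<open>\<Prod>\<^sub>i exp (y\<^sub>i\<^sup>2 / 8)\<close>. Coefficients of mixed sign are
  split into positive and negative parts by \<open>exp ((U + V) / 2) \<le> (exp U + exp V) / 2\<close>; this doubles
  the coefficients, so the exponent becomes \<open>\<lambda>\<^sup>2 \<Sum> a\<^sub>n\<^sup>2 / 2\<close> at most.
\<close>

section \<open>Positive definite matrices, Schur complements and Hadamard's inequality\<close>

definition sesquilinear_form :: "nat \<Rightarrow> (nat \<Rightarrow> nat \<Rightarrow> complex) \<Rightarrow> (nat \<Rightarrow> complex) \<Rightarrow> complex" where
  "sesquilinear_form n A c = (\<Sum>i<n. \<Sum>j<n. cnj (c i) * A i j * c j)"

definition posdef :: "nat \<Rightarrow> (nat \<Rightarrow> nat \<Rightarrow> complex) \<Rightarrow> bool" where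
  "posdef n A \<longleftrightarrow> (\<forall>i<n. \<forall>j<n. A j i = cnj (A i j)) \<and>
     (\<forall>c. (\<exists>i<n. c i \<noteq> 0) \<longrightarrow> 0 < Re (sesquilinear_form n A c))"

text \<open>What eliminating column 0 with pivot \<open>A 0 0\<close> leaves in the other rows and
  columns, renumbered from 0. With matrices as index functions this is a plain shift.\<close>

definition schur_complement :: "(nat \<Rightarrow> nat \<Rightarrow> 'a::field) \<Rightarrow> nat \<Rightarrow> nat \<Rightarrow> 'a" where
  "schur_complement A i j = A (Suc i) (Suc j) - A (Suc i) 0 * A 0 (Suc j) / A 0 0"

text \<open>One step of Gaussian elimination as a factorization \<open>L * U\<close>:
  \<open>L\<close> is unit lower triangular with the multipliers in column 0, and column 0 of
  \<open>U\<close> vanishes below the pivot.\<close>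

lemma det_schur_complement:
  fixes A :: "nat \<Rightarrow> nat \<Rightarrow> 'a::field"
  assumes "A 0 0 \<noteq> 0"
  shows "Determinant.det (Matrix.mat (Suc n) (Suc n) (\<lambda>(i, j). A i j)) =
           A 0 0 * Determinant.det (Matrix.mat n n (\<lambda>(i, j). schur_complement A i j))"
proof -
  define L where "L = Matrix.mat (Suc n) (Suc n)
    (\<lambda>(i, j). if i = j then 1 else if j = 0 then A i 0 / A 0 0 else 0)"
  define U where "U = Matrix.mat (Suc n) (Suc n)
    (\<lambda>(i, j). if i = 0 then A 0 j else if j = 0 then 0 else schur_complement A (i - 1) (j - 1))"
  have L: "L \<in> carrier_mat (Suc n) (Suc n)" and U: "U \<in> carrier_mat (Suc n) (Suc n)"
    by (auto simp: L_def U_def)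
  have "Matrix.mat (Suc n) (Suc n) (\<lambda>(i, j). A i j) = L * U"
  proof (rule eq_matI)
    fix i j assume "i < dim_row (L * U)" "j < dim_col (L * U)"
    then have ij: "i < Suc n" "j < Suc n" by (auto simp: L_def U_def)
    have "(L * U) $$ (i, j) = (\<Sum>k = 0..<Suc n. L $$ (i, k) * U $$ (k, j))"
      using ij L U by (auto simp: scalar_prod_def)
    \<comment> \<open>Row \<open>i\<close> of \<open>L\<close> is supported on \<open>k = i\<close>
      and \<open>k = 0\<close>; for \<open>i = 0\<close> the two coincide and must be counted
      once.\<close>
    also have "\<dots> = (\<Sum>k = 0..<Suc n. (if k = i then U $$ (i, j) else 0) +
                       (if k = 0 then (if i = 0 then 0 else A i 0 / A 0 0 * A 0 j) else 0))"
      using ij by (intro sum.cong) (auto simp: L_def U_def)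
    also have "\<dots> = U $$ (i, j) + (if i = 0 then 0 else A i 0 / A 0 0 * A 0 j)"
      using ij by (simp add: sum.distrib del: sum.op_ivl_Suc)
    also have "\<dots> = A i j"
      using ij assms by (auto simp: U_def schur_complement_def)
    finally show "Matrix.mat (Suc n) (Suc n) (\<lambda>(i, j). A i j) $$ (i, j) = (L * U) $$ (i, j)"
      using ij by simp
  qed (auto simp: L_def U_def)
  moreover have "Determinant.det L = 1"
  proof -
    have "diag_mat L = replicate (Suc n) 1"
      by (rule nth_equalityI) (auto simp: L_def diag_mat_def simp del: upt_Suc replicate_Suc)
    then show ?thesis
      by (subst det_lower_triangular[OF _ L]) (auto simp: L_def)
  qed
  moreover have "Determinant.det U = (\<Sum>i<Suc n. U $$ (i, 0) * cofactor U i 0)"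
    by (rule laplace_expansion_column[OF U]) simp
  moreover have "\<dots> = (\<Sum>i<Suc n. if i = 0 then A 0 0 * cofactor U 0 0 else 0)"
    by (intro sum.cong) (auto simp: U_def)
  moreover have "mat_delete U 0 0 = Matrix.mat n n (\<lambda>(i, j). schur_complement A i j)"
    by (rule eq_matI) (auto simp: mat_delete_def U_def)
  ultimately show ?thesis
    by (simp add: det_mult[OF L U] cofactor_def del: sum.lessThan_Suc)
qed

text \<open>Testing the form on a unit vector reads off a diagonal entry.\<close>

lemma posdef_diagonal:
  assumes "posdef n A" "i < n"
  shows "A i i = complex_of_real (Re (A i i))" "0 < Re (A i i)"
proof -
  have "A i i = cnj (A i i)" using assms unfolding posdef_def by blast
  then have "A i i \<in> \<real>" unfolding Reals_cnj_iff by (rule sym)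
  then show "A i i = complex_of_real (Re (A i i))" by (rule of_real_Re[symmetric])
  let ?c = "\<lambda>k. if k = i then 1 else 0 :: complex"
  have "sesquilinear_form n A ?c = (\<Sum>k<n. \<Sum>l<n. if l = i then (if k = i then A i i else 0) else 0)"
    unfolding sesquilinear_form_def by (intro sum.cong) auto
  also have "\<dots> = A i i" using assms(2) by simp
  finally have "sesquilinear_form n A ?c = A i i" .
  moreover have "\<exists>k<n. ?c k \<noteq> 0" using assms(2) by auto
  then have "0 < Re (sesquilinear_form n A ?c)"
    by (rule assms(1)[unfolded posdef_def, THEN conjunct2, rule_format])
  ultimately show "0 < Re (A i i)" by simp
qed

text \<open>Minimizing the form of \<open>A\<close> over coordinate 0, with the others held at
  \<open>c\<close>, gives exactly the form of the Schur complement at \<open>c\<close>, so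
  positivity is inherited.\<close>

lemma posdef_schur_complement:
  assumes "posdef (Suc n) A"
  shows "posdef n (schur_complement A)"
proof -
  have herm: "A j i = cnj (A i j)" if "i < Suc n" "j < Suc n" for i j
    using assms that unfolding posdef_def by blast
  define \<alpha> where "\<alpha> = A 0 0"
  have \<alpha>: "\<alpha> \<noteq> 0" "cnj \<alpha> = \<alpha>"
    using posdef_diagonal(2)[OF assms, of 0] herm[of 0 0, symmetric] by (auto simp: \<alpha>_def)
  have pos: "0 < Re (sesquilinear_form n (schur_complement A) c)"
    if c: "\<exists>i<n. c i \<noteq> 0" for c
  proof -
    define s where "s = (\<Sum>j<n. A 0 (Suc j) * c j)"
    define q where "q = (\<Sum>i<n. \<Sum>j<n. cnj (c i) * A (Suc i) (Suc j) * c j)"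
    have s': "(\<Sum>i<n. cnj (c i) * A (Suc i) 0) = cnj s"
      unfolding s_def cnj_sum by (intro sum.cong) (auto simp: herm[of 0 "Suc _"])
    have "sesquilinear_form n (schur_complement A) c =
        q - (\<Sum>i<n. \<Sum>j<n. (cnj (c i) * A (Suc i) 0) * (A 0 (Suc j) * c j)) / \<alpha>"
    proof -
      have "cnj (c i) * schur_complement A i j * c j = cnj (c i) * A (Suc i) (Suc j) * c j -
          (cnj (c i) * A (Suc i) 0) * (A 0 (Suc j) * c j) / \<alpha>" for i j
        by (simp add: schur_complement_def \<alpha>_def[symmetric] algebra_simps)
      then show ?thesis
        by (simp only: sesquilinear_form_def q_def sum_subtractf sum_divide_distrib)
    qed
    also have "(\<Sum>i<n. \<Sum>j<n. (cnj (c i) * A (Suc i) 0) * (A 0 (Suc j) * c j)) = cnj s * s"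
      by (simp add: sum_product[symmetric] s' s_def[symmetric])
    finally have S: "sesquilinear_form n (schur_complement A) c = q - cnj s * s / \<alpha>" .
    \<comment> \<open>The minimizer, found by completing the square; \<open>case_nat t c\<close>
      puts it in front of \<open>c\<close>.\<close>
    define t where "t = - s / \<alpha>"
    define c' where "c' = case_nat t c"
    have "(\<Sum>j<n. cnj t * A 0 (Suc j) * c j) = cnj t * s"
      by (simp add: s_def sum_distrib_left mult.assoc)
    moreover have "(\<Sum>i<n. cnj (c i) * A (Suc i) 0 * t) = cnj s * t"
      by (simp add: s'[symmetric] sum_distrib_right)
    ultimately have "sesquilinear_form (Suc n) A c' = cnj t * \<alpha> * t + cnj t * s + (cnj s * t + q)"
      unfolding sesquilinear_form_def
      by (simp add: sum.lessThan_Suc_shift c'_def \<alpha>_def sum.distrib q_def del: sum.lessThan_Suc)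
    also have "\<dots> = q - cnj s * s / \<alpha>"
      using \<alpha> by (simp add: t_def field_simps)
    finally have "sesquilinear_form (Suc n) A c' = sesquilinear_form n (schur_complement A) c"
      by (simp add: S)
    moreover have "\<exists>i<Suc n. c' i \<noteq> 0"
      using c by (force simp: c'_def)
    then have "0 < Re (sesquilinear_form (Suc n) A c')"
      using assms unfolding posdef_def by blast
    ultimately show ?thesis by simp
  qed
  moreover have "schur_complement A j i = cnj (schur_complement A i j)" if "i < n" "j < n" for i j
    using that herm[of "Suc i" "Suc j"] herm[of 0 "Suc i"] herm[of 0 "Suc j"] \<alpha>
    by (simp add: schur_complement_def \<alpha>_def[symmetric])
  ultimately show ?thesis unfolding posdef_def by blast
qed

text \<open>Induction along Schur complements: the determinant is the pivot times that of the
  complement, and each diagonal entry of the complement arises from one of \<open>A\<close> by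
  subtracting a squared modulus divided by the positive pivot.\<close>

lemma hadamard_inequality:
  assumes "posdef n A"
  shows "\<exists>r. Determinant.det (Matrix.mat n n (\<lambda>(i, j). A i j)) = complex_of_real r \<and>
             0 < r \<and> r \<le> (\<Prod>i<n. Re (A i i))"
  using assms
proof (induction n arbitrary: A)
  case 0
  then show ?case by (intro exI[of _ 1]) simp
next
  case (Suc n)
  note pos = posdef_diagonal[OF Suc.prems]
  note pos' = posdef_diagonal[OF posdef_schur_complement[OF Suc.prems]]
  obtain r where r: "Determinant.det (Matrix.mat n n (\<lambda>(i, j). schur_complement A i j)) = complex_of_real r"
    "0 < r" "r \<le> (\<Prod>i<n. Re (schur_complement A i i))"
    using Suc.IH[OF posdef_schur_complement[OF Suc.prems]] by auto
  have "Re (schur_complement A i i) \<le> Re (A (Suc i) (Suc i))" if "i < n" for i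
  proof -
    have "A (Suc i) 0 = cnj (A 0 (Suc i))"
      using Suc.prems that unfolding posdef_def by blast
    then have "A (Suc i) 0 * A 0 (Suc i) = complex_of_real ((cmod (A 0 (Suc i)))\<^sup>2)"
      by (simp add: complex_norm_square mult.commute del: of_real_power)
    then have "A (Suc i) 0 * A 0 (Suc i) / A 0 0 =
        complex_of_real ((cmod (A 0 (Suc i)))\<^sup>2 / Re (A 0 0))"
      using pos(1)[of 0] by (metis of_real_divide zero_less_Suc)
    then show ?thesis
      using pos(2)[of 0] by (simp add: schur_complement_def)
  qed
  then have "(\<Prod>i<n. Re (schur_complement A i i)) \<le> (\<Prod>i<n. Re (A (Suc i) (Suc i)))"
    using pos' by (intro prod_mono) (auto simp: less_imp_le)
  then have "Re (A 0 0) * r \<le> (\<Prod>i<Suc n. Re (A i i))"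
    unfolding prod.lessThan_Suc_shift using pos(2)[of 0] r(3) by (intro mult_left_mono) auto
  moreover have "Determinant.det (Matrix.mat (Suc n) (Suc n) (\<lambda>(i, j). A i j)) =
      complex_of_real (Re (A 0 0) * r)"
    using pos(2)[of 0] pos(1)[of 0, symmetric] r(1) by (subst det_schur_complement) auto
  moreover have "0 < Re (A 0 0) * r" using pos(2)[of 0] r(2) by simp
  ultimately show ?case by blast
qed

section \<open>Expectations of products as determinants\<close>

text \<open>In the Leibniz formula every permutation picks each row weight and each column weight
  exactly once, so the same factor leaves every term.\<close>

lemma det_mat_scale_rows_cols:
  fixes A :: "nat \<Rightarrow> nat \<Rightarrow> 'a::comm_ring_1"
  shows "Determinant.det (Matrix.mat n n (\<lambda>(i, j). u i * A i j * v j)) =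
           (\<Prod>i<n. u i * v i) * Determinant.det (Matrix.mat n n (\<lambda>(i, j). A i j))"
proof -
  have prod: "(\<Prod>i = 0..<n. Matrix.mat n n (\<lambda>(i, j). u i * A i j * v j) $$ (i, p i)) =
      (\<Prod>i<n. u i * v i) * (\<Prod>i = 0..<n. Matrix.mat n n (\<lambda>(i, j). A i j) $$ (i, p i))"
    if p: "p permutes {0..<n}" for p
  proof -
    have "p i < n" if "i < n" for i
      using that permutes_in_image[OF p, of i] by simp
    then have "(\<Prod>i = 0..<n. Matrix.mat n n (\<lambda>(i, j). u i * A i j * v j) $$ (i, p i)) =
        (\<Prod>i = 0..<n. u i * Matrix.mat n n (\<lambda>(i, j). A i j) $$ (i, p i) * v (p i))"
      by (intro prod.cong) auto
    then show ?thesis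
      using prod.permute[OF p, of v]
      by (simp only: prod.distrib comp_def atLeast0LessThan mult_ac)
  qed
  have "Determinant.det (Matrix.mat n n (\<lambda>(i, j). u i * A i j * v j)) =
      (\<Sum>p\<in>{p. p permutes {0..<n}}. (\<Prod>i<n. u i * v i) *
        (signof p * (\<Prod>i = 0..<n. Matrix.mat n n (\<lambda>(i, j). A i j) $$ (i, p i))))"
    by (subst det_def'[of _ n]) (auto simp only: prod mult.left_commute mat_carrier intro!: sum.cong)
  also have "\<dots> = (\<Prod>i<n. u i * v i) * Determinant.det (Matrix.mat n n (\<lambda>(i, j). A i j))"
    by (subst det_def'[of "Matrix.mat n n (\<lambda>(i, j). A i j)" n]) (simp_all only: sum_distrib_left mat_carrier)
  finally show ?thesis .
qed

text \<open>Row \<open>i\<close> is \<open>d i\<close> times a unit vector plus the row without that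
  diagonal term; linearity in the row produces the principal minor at \<open>i\<close>. The map
  \<open>insert_index i\<close> skips \<open>i\<close>, as the renumbering in
  \<open>mat_delete\<close> does.\<close>

lemma det_mat_split_diagonal:
  fixes B :: "nat \<Rightarrow> nat \<Rightarrow> 'a::comm_ring_1" and d :: "nat \<Rightarrow> 'a"
  assumes "i < Suc n"
  defines "e \<equiv> insert_index i"
  shows "Determinant.det (Matrix.mat (Suc n) (Suc n) (\<lambda>(k, l). (if k = l then d k else 0) + B k l)) =
     d i * Determinant.det (Matrix.mat n n (\<lambda>(k, l). (if k = l then d (e k) else 0) + B (e k) (e l))) +
     Determinant.det (Matrix.mat (Suc n) (Suc n) (\<lambda>(k, l). (if k = l then (d(i := 0)) k else 0) + B k l))"
    (is "Determinant.det ?A = d i * Determinant.det ?A' + Determinant.det ?Z")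
proof -
  have A: "?A \<in> carrier_mat (Suc n) (Suc n)" "?Z \<in> carrier_mat (Suc n) (Suc n)" by auto
  \<comment> \<open>The two matrices differ only at \<open>(i, i)\<close>, so deleting row
    \<open>i\<close> makes them equal and the cofactors along that row agree.\<close>
  have del: "mat_delete ?A i j = mat_delete ?Z i j" if "j < Suc n" for j
    using that assms by (intro eq_matI) (auto simp: mat_delete_def)
  have del_i: "mat_delete ?Z i i = ?A'"
    using assms by (intro eq_matI) (auto simp: mat_delete_def insert_index_def)
  have "Determinant.det ?A = (\<Sum>j<Suc n. ?A $$ (i, j) * cofactor ?A i j)"
    by (rule laplace_expansion_row[OF A(1) assms(1)])
  also have "\<dots> = (\<Sum>j<Suc n. (if j = i then d i * cofactor ?Z i i else 0) + ?Z $$ (i, j) * cofactor ?Z i j)"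
    using assms del by (intro sum.cong) (auto simp: cofactor_def algebra_simps)
  also have "\<dots> = d i * cofactor ?Z i i + Determinant.det ?Z"
    using assms(1) by (simp add: sum.distrib laplace_expansion_row[OF A(2) assms(1)] del: sum.lessThan_Suc)
  finally show ?thesis by (simp add: cofactor_def del_i)
qed

text \<open>Uses the renumbering of the determinant expansion, so that integrand and determinant
  split alike in the induction below.\<close>

lemma prod_lessThan_Suc_remove:
  fixes g :: "nat \<Rightarrow> 'a::comm_monoid_mult"
  assumes "i < Suc n"
  shows "(\<Prod>k<Suc n. g k) = g i * (\<Prod>k<n. g (insert_index i k))"
proof -
  have "insert_index i ` {..<n} = {..<Suc n} - {i}"
    using assms insert_index_image[of i n] by (auto simp: atLeast0LessThan)
  then have "prod g ({..<Suc n} - {i}) = (\<Prod>k<n. g (insert_index i k))"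
    by (metis (no_types, lifting) insert_index_inj_on prod.reindex_cong)
  then show ?thesis using assms by (subst prod.remove[of _ i]) auto
qed

lemma determinantal_product_integrable:
  assumes "determinantal_process M K X"
  shows "integrable M (\<lambda>\<omega>. \<Prod>i<n. d i + w i * occupation X (ns i) \<omega>)"
proof -
  interpret prob_space M using assms by (simp add: determinantal_process_def)
  have [measurable]: "occupation X k \<in> borel_measurable M" for k
    using assms by (simp add: determinantal_process_def)
  have "\<bar>\<Prod>i<n. d i + w i * occupation X (ns i) \<omega>\<bar> \<le> (\<Prod>i<n. \<bar>d i\<bar> + \<bar>w i\<bar>)" for \<omega>
    unfolding abs_prod
    by (intro prod_mono) (auto simp: occupation_def indicator_def)
  then show ?thesis
    by (intro integrable_const_bound[where B = "\<Prod>i<n. \<bar>d i\<bar> + \<bar>w i\<bar>"]) auto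
qed

text \<open>
  The diagonal entries \<open>d\<^sub>i\<close> are kept general so that the induction can remove them one at a time, by
  linearity of the determinant in row \<open>i\<close>; when all vanish the formula is the defining one. The
  factorization of \<open>w\<^sub>i\<close> into a row and a column weight allows a Hermitian matrix on the right.
\<close>
lemma determinantal_expectation:
  assumes process: "determinantal_process M K X"
    and "inj_on ns {..<n}"
    and "\<And>i. complex_of_real (w i) = u i * v i"
  shows "complex_of_real (LINT \<omega>|M. (\<Prod>i<n. d i + w i * occupation X (ns i) \<omega>)) =
    Determinant.det (Matrix.mat n n (\<lambda>(i, j).
      (if i = j then complex_of_real (d i) else 0) + u i * K (ns i) (ns j) * v j))"
  using assms(2,3)
\<comment> \<open>The measure counts nonzero \<open>d i\<close> instead of using \<open>n\<close>:
  one recursive call drops an index, but the other keeps the size and only sets one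
  \<open>d i\<close> to 0.\<close>
proof (induction "card {i. i < n \<and> d i \<noteq> 0}" arbitrary: n d u v w ns rule: less_induct)
  case less
  show ?case
  proof (cases "\<exists>i<n. d i \<noteq> 0")
    case False
    let ?ns = "map ns [0..<n]"
    have "distinct ?ns"
      using less.prems(1) by (simp add: distinct_map atLeast0LessThan)
    moreover have "Matrix.mat (length ?ns) (length ?ns) (\<lambda>(i, j). K (?ns ! i) (?ns ! j)) =
        Matrix.mat n n (\<lambda>(i, j). K (ns i) (ns j))"
      by (rule eq_matI) auto
    ultimately have K: "complex_of_real (LINT \<omega>|M. (\<Prod>i<n. occupation X (ns i) \<omega>)) =
        Determinant.det (Matrix.mat n n (\<lambda>(i, j). K (ns i) (ns j)))"
      using process[unfolded determinantal_process_def, THEN conjunct2, THEN conjunct2, THEN spec, of ?ns]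
      by simp
    have "Matrix.mat n n (\<lambda>(i, j). (if i = j then complex_of_real (d i) else 0) + u i * K (ns i) (ns j) * v j) =
        Matrix.mat n n (\<lambda>(i, j). u i * K (ns i) (ns j) * v j)"
      using False by (intro cong_mat) auto
    moreover have "(\<Prod>i<n. d i + w i * occupation X (ns i) \<omega>) =
        (\<Prod>i<n. w i) * (\<Prod>i<n. occupation X (ns i) \<omega>)" for \<omega>
      unfolding prod.distrib[symmetric] using False by (intro prod.cong) auto
    ultimately show ?thesis
      by (simp add: det_mat_scale_rows_cols K[symmetric] less.prems(2)[symmetric])
  next
    case True
    then obtain i m where i: "i < Suc m" "d i \<noteq> 0" and n: "n = Suc m"
      by (metis less_imp_Suc_add)
    let ?e = "insert_index i"
    let ?S = "{k. k < Suc m \<and> d k \<noteq> 0}"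
    let ?g = "\<lambda>\<omega> k. d k + w k * occupation X (ns k) \<omega>"
    have "?e ` {k. k < m \<and> d (?e k) \<noteq> 0} \<subseteq> ?S - {i}"
      by (auto simp: insert_index_def)
    then have "card {k. k < m \<and> d (?e k) \<noteq> 0} \<le> card (?S - {i})"
      by (rule card_inj_on_le[OF insert_index_inj_on]) simp
    also have "\<dots> < card ?S" using i by (intro psubset_card_mono) auto
    finally have lt: "card {k. k < m \<and> d (?e k) \<noteq> 0} < card {i. i < n \<and> d i \<noteq> 0}"
      by (simp add: n)
    have inj: "inj_on (\<lambda>k. ns (?e k)) {..<m}"
    proof -
      have "?e ` {..<m} \<subseteq> {..<n}" by (auto simp: n insert_index_def)
      from comp_inj_on[OF insert_index_inj_on inj_on_subset[OF less.prems(1) this]]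
      show ?thesis by (simp add: comp_def)
    qed
    have lt0: "card {k. k < n \<and> (d(i := 0)) k \<noteq> 0} < card {i. i < n \<and> d i \<noteq> 0}"
      using i n by (intro psubset_card_mono) (auto split: if_splits)
    note IH = less.hyps[OF lt inj, of "\<lambda>k. w (?e k)" "\<lambda>k. u (?e k)" "\<lambda>k. v (?e k)"]
      and IH0 = less.hyps[OF lt0 less.prems(1), of w u v, OF less.prems(2)]
    have "(\<Prod>k<n. ?g \<omega> k) = d i * (\<Prod>k<m. ?g \<omega> (?e k)) +
        (\<Prod>k<n. (d(i := 0)) k + w k * occupation X (ns k) \<omega>)" for \<omega>
      unfolding n by (subst (1 2) prod_lessThan_Suc_remove[OF i(1)]) (simp add: algebra_simps)
    then have E: "(LINT \<omega>|M. (\<Prod>k<n. ?g \<omega> k)) = d i * (LINT \<omega>|M. (\<Prod>k<m. ?g \<omega> (?e k))) +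
        (LINT \<omega>|M. (\<Prod>k<n. (d(i := 0)) k + w k * occupation X (ns k) \<omega>))"
      using determinantal_product_integrable[OF process, of "\<lambda>k. d (?e k)" "\<lambda>k. w (?e k)" "\<lambda>k. ns (?e k)" m]
        determinantal_product_integrable[OF process, of "d(i := 0)" w ns n]
      by (simp del: fun_upd_apply)
    \<comment> \<open>Moves the coercion inside the update, so that the diagonal is a complex
      function updated at \<open>i\<close>, as the determinant expansion expects.\<close>
    have upd: "complex_of_real ((d(i := 0)) k) = ((\<lambda>k. complex_of_real (d k))(i := 0)) k" for k
      by simp
    show ?thesis
      unfolding E of_real_add of_real_mult IH[OF less.prems(2)] IH0 upd
      unfolding n by (rule det_mat_split_diagonal[OF i(1), symmetric])
  qed
qed

section \<open>Hoeffding's bound for a Bernoulli variable\<close>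

text \<open>For nonnegative \<open>y\<close> this is \<open>Hoeffdings_lemma_aux\<close>
  exponentiated; a negative \<open>y\<close> is reduced to it by exchanging the two outcomes, which
  replaces \<open>(y, p)\<close> by \<open>(- y, 1 - p)\<close>.\<close>

lemma bernoulli_mgf_le:
  fixes p y :: real
  assumes "0 \<le> p" "p \<le> 1"
  shows "exp (- y * p) * (1 + (exp y - 1) * p) \<le> exp (y\<^sup>2 / 8)"
proof -
  have *: "exp (- h * q) * (1 + (exp h - 1) * q) \<le> exp (h\<^sup>2 / 8)" if "0 \<le> h" "0 \<le> q" for h q :: real
  proof -
    have pos: "0 < 1 + q * (exp h - 1)"
      using that by (intro add_pos_nonneg mult_nonneg_nonneg) auto
    have "- h * q + ln (1 + q * (exp h - 1)) \<le> h\<^sup>2 / 8"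
      using Hoeffdings_lemma_aux[OF that] by simp
    then have "exp (- h * q + ln (1 + q * (exp h - 1))) \<le> exp (h\<^sup>2 / 8)" by simp
    then show ?thesis unfolding exp_add exp_ln[OF pos] by (simp add: mult.commute)
  qed
  show ?thesis
  proof (cases "0 \<le> y")
    case False
    have "exp (- y * p) * (1 + (exp y - 1) * p) = exp (y * (1 - p)) * (1 + (exp (- y) - 1) * (1 - p))"
      by (simp add: algebra_simps exp_diff exp_minus exp_add field_simps)
    then show ?thesis using *[of "- y" "1 - p"] False assms by simp
  qed (use * assms in auto)
qed

section \<open>Fourier coefficients and the Toeplitz quadratic form\<close>

lemma circle_integrable_bounded:
  fixes g :: "real \<Rightarrow> 'b::{banach, second_countable_topology}"
  assumes "g \<in> borel_measurable borel" "\<And>t. norm (g t) \<le> B"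
  shows "set_integrable lborel {0..<1} g"
  unfolding set_integrable_def
  by (rule integrableI_bounded_set_indicator[where B = B]) (use assms in auto)

lemma circle_integral_sum:
  assumes "\<And>i. i \<in> I \<Longrightarrow> set_integrable lborel {0..<1} (g i)"
  shows "circle_integral (\<lambda>t. \<Sum>i\<in>I. g i t) = (\<Sum>i\<in>I. circle_integral (g i))"
  using assms
  by (simp add: circle_integral_def set_lebesgue_integral_def set_integrable_def scaleR_sum_right)

text \<open>This makes the Toeplitz kernel Hermitian.\<close>

lemma fourier_coeff_minus: "fourier_coeff f (- k) = cnj (fourier_coeff f k)"
  unfolding fourier_coeff_def circle_integral_def set_lebesgue_integral_def
  by (subst Bochner_Integration.integral_cnj[symmetric]) (simp add: exp_cnj)

lemma fourier_coeff_0: "fourier_coeff f 0 = complex_of_real (circle_integral f)"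
  by (simp add: fourier_coeff_def circle_integral_def set_integral_complex_of_real)

text \<open>The Toeplitz matrix of the symbol 1 is thus the identity, which later turns
  \<open>f \<le> 1\<close> into a comparison of the kernel with the identity.\<close>

lemma fourier_coeff_one: "fourier_coeff (\<lambda>_. 1) k = (if k = 0 then 1 else 0)"
proof (cases "k = 0")
  case True
  then show ?thesis
    by (simp add: fourier_coeff_0 circle_integral_def set_lebesgue_integral_def)
next
  case False
  define z where "z = - 2 * of_real pi * \<i> * of_int k"
  have z: "z \<noteq> 0" using False by (simp add: z_def)
  \<comment> \<open>Adding the endpoint 1 changes a null set only and gives the closed interval on
    which the fundamental theorem of calculus is applied.\<close>
  have "fourier_coeff (\<lambda>_. 1) k = (LINT t|lborel. indicator {0..1} t *\<^sub>R exp (z * of_real t))"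
    unfolding fourier_coeff_def circle_integral_def set_lebesgue_integral_def z_def[symmetric]
    using AE_lborel_singleton[of "1::real"]
    by (intro integral_cong_AE) (auto simp: indicator_def elim!: eventually_mono)
  also have "\<dots> = exp (z * of_real 1) / z - exp (z * of_real 0) / z"
    by (rule integral_FTC_Icc)
       (use z in \<open>auto intro!: derivative_eq_intros continuous_intros has_vector_derivative_real_field\<close>)
  also have "exp (z * of_real 1) = 1"
    unfolding exp_eq_1 by (auto simp: z_def intro!: exI[of _ "- k"])
  finally show ?thesis using False by simp
qed

text \<open>The character of frequency \<open>i - j\<close> splits into a conjugated factor for
  \<open>i\<close> and a factor for \<open>j\<close>, so the double sum under the integral is
  \<open>f\<close> times the squared modulus of the trigonometric polynomial with coefficients
  \<open>c\<close>.\<close>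

lemma sesquilinear_form_toeplitz:
  assumes f: "f \<in> borel_measurable borel" "\<And>t. \<bar>f t\<bar> \<le> B"
  shows "sesquilinear_form n (\<lambda>i j. toeplitz_kernel f (int i) (int j)) c =
    complex_of_real (circle_integral (\<lambda>t. f t * (cmod (\<Sum>j<n. c j * cis (2 * pi * j * t)))\<^sup>2))"
proof -
  let ?e = "\<lambda>j t. c j * cis (2 * pi * real j * t)"
  let ?g = "\<lambda>i j t. cnj (c i) * (complex_of_real (f t) *
    exp (- 2 * of_real pi * \<i> * of_int (int i - int j) * of_real t)) * c j"
  have int: "set_integrable lborel {0..<1} (?g i j)" for i j
  proof (rule circle_integrable_bounded[where B = "cmod (c i) * B * cmod (c j)"])
    show "?g i j \<in> borel_measurable borel" using f(1) by measurable
    show "cmod (?g i j t) \<le> cmod (c i) * B * cmod (c j)" for t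
      using f(2)[of t] by (auto simp: norm_mult intro!: mult_mono)
  qed
  then have int': "set_integrable lborel {0..<1} (\<lambda>t. \<Sum>j<n. ?g i j t)" for i
    unfolding set_integrable_def scaleR_sum_right
    by (intro Bochner_Integration.integrable_sum)
  have "cnj (c i) * toeplitz_kernel f (int i) (int j) * c j = circle_integral (?g i j)" for i j
    unfolding toeplitz_kernel_def fourier_coeff_def circle_integral_def
    by simp
  then have "sesquilinear_form n (\<lambda>i j. toeplitz_kernel f (int i) (int j)) c =
      circle_integral (\<lambda>t. \<Sum>i<n. \<Sum>j<n. ?g i j t)"
    unfolding sesquilinear_form_def by (simp only: circle_integral_sum int int')
  also have "(\<lambda>t. \<Sum>i<n. \<Sum>j<n. ?g i j t) =
      (\<lambda>t. complex_of_real (f t * (cmod (\<Sum>j<n. ?e j t))\<^sup>2))"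
  proof
    fix t
    have "?g i j t = complex_of_real (f t) * (cnj (?e i t) * ?e j t)" for i j
    proof -
      have "exp (- 2 * of_real pi * \<i> * of_int (int i - int j) * of_real t) =
          cnj (cis (2 * pi * real i * t)) * cis (2 * pi * real j * t)"
        by (simp add: cis_cnj cis_mult) (simp add: cis_conv_exp algebra_simps)
      then show ?thesis by simp
    qed
    then have "(\<Sum>i<n. \<Sum>j<n. ?g i j t) =
        complex_of_real (f t) * (cnj (\<Sum>i<n. ?e i t) * (\<Sum>j<n. ?e j t))"
      by (simp only: cnj_sum, simp only: sum_product, simp only: sum_distrib_left)
    then show "(\<Sum>i<n. \<Sum>j<n. ?g i j t) = complex_of_real (f t * (cmod (\<Sum>j<n. ?e j t))\<^sup>2)"
      by (simp add: complex_norm_square mult.commute del: of_real_power cnj_sum)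
  qed
  finally show ?thesis
    by (simp add: circle_integral_def set_integral_complex_of_real del: of_real_mult)
qed

lemma sesquilinear_form_toeplitz_bounds:
  assumes f: "f \<in> borel_measurable borel" "\<And>t. f t \<in> {0..1}"
  shows "0 \<le> Re (sesquilinear_form n (\<lambda>i j. toeplitz_kernel f (int i) (int j)) c)"
    and "Re (sesquilinear_form n (\<lambda>i j. toeplitz_kernel f (int i) (int j)) c) \<le> (\<Sum>i<n. (cmod (c i))\<^sup>2)"
proof -
  let ?h = "\<lambda>t. (cmod (\<Sum>j<n. c j * cis (2 * pi * j * t)))\<^sup>2"
  have h: "?h t \<le> (\<Sum>j<n. cmod (c j))\<^sup>2" for t
    by (intro power_mono order.trans[OF norm_sum]) (auto simp: norm_mult)
  \<comment> \<open>Stated for a general symbol \<open>g\<close>, to be used both for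
    \<open>f\<close> and for the constant 1.\<close>
  have form: "Re (sesquilinear_form n (\<lambda>i j. toeplitz_kernel g (int i) (int j)) c) =
      circle_integral (\<lambda>t. g t * ?h t)"
    and int: "set_integrable lborel {0..<1} (\<lambda>t. g t * ?h t)"
    if g: "g \<in> borel_measurable borel" "\<And>t. g t \<in> {0..1}" for g
  proof -
    show "Re (sesquilinear_form n (\<lambda>i j. toeplitz_kernel g (int i) (int j)) c) =
        circle_integral (\<lambda>t. g t * ?h t)"
      by (subst sesquilinear_form_toeplitz[where B = 1]) (use g in auto)
    have "(\<lambda>t. cis (2 * pi * real j * t)) \<in> borel_measurable borel" for j
      by (intro borel_measurable_continuous_onI continuous_intros)
    then have "?h \<in> borel_measurable borel" by measurable
    moreover have "\<bar>g t * ?h t\<bar> \<le> 1 * (\<Sum>j<n. cmod (c j))\<^sup>2" for t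
      unfolding abs_mult using g(2)[of t] h[of t] by (intro mult_mono) auto
    ultimately show "set_integrable lborel {0..<1} (\<lambda>t. g t * ?h t)"
      using g(1) by (intro circle_integrable_bounded) auto
  qed
  show "0 \<le> Re (sesquilinear_form n (\<lambda>i j. toeplitz_kernel f (int i) (int j)) c)"
    unfolding form[OF f] circle_integral_def set_lebesgue_integral_def
    using f(2) by (intro integral_nonneg_AE) auto
  have "circle_integral (\<lambda>t. f t * ?h t) \<le> circle_integral (\<lambda>t. 1 * ?h t)"
    unfolding circle_integral_def
    using f by (intro set_integral_mono int mult_right_mono) auto
  \<comment> \<open>Parseval's identity, obtained from the same integral formula at the symbol
    1.\<close>
  also have "\<dots> = Re (sesquilinear_form n (\<lambda>i j. toeplitz_kernel (\<lambda>_. 1) (int i) (int j)) c)"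
    by (subst form) auto
  also have "\<dots> = (\<Sum>i<n. \<Sum>j<n. if j = i then (cmod (c i))\<^sup>2 else 0)"
    unfolding sesquilinear_form_def Re_sum
    by (intro sum.cong) (auto simp: toeplitz_kernel_def fourier_coeff_one cmod_def power2_eq_square)
  also have "\<dots> = (\<Sum>i<n. (cmod (c i))\<^sup>2)" by simp
  finally show "Re (sesquilinear_form n (\<lambda>i j. toeplitz_kernel f (int i) (int j)) c) \<le> (\<Sum>i<n. (cmod (c i))\<^sup>2)"
    unfolding form[OF f] .
qed

section \<open>Product and exponential moments for coefficients of one sign\<close>

text \<open>With \<open>S\<close> the diagonal matrix of \<open>s\<close>, adding
  \<open>S K S\<close> to the identity keeps it positive because \<open>K\<close> is nonnegative;
  subtracting it does so because \<open>S K S\<close> is at most \<open>S S\<close>, which is below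
  the identity.\<close>

lemma posdef_identity_plus_scaled:
  fixes s :: "nat \<Rightarrow> real"
  assumes herm: "\<And>i j. K j i = cnj (K i j)"
    and bounds: "\<And>c. 0 \<le> Re (sesquilinear_form n K c)"
      "\<And>c. Re (sesquilinear_form n K c) \<le> (\<Sum>i<n. (cmod (c i))\<^sup>2)"
    and \<epsilon>: "\<epsilon> = 1 \<or> \<epsilon> = - 1 \<and> (\<forall>i<n. (s i)\<^sup>2 < 1)"
  shows "posdef n (\<lambda>i j. (if i = j then 1 else 0) +
    complex_of_real (\<epsilon> * s i) * K i j * complex_of_real (s j))"
    (is "posdef n ?A")
  unfolding posdef_def
proof (intro conjI allI impI)
  fix i j show "?A j i = cnj (?A i j)" using herm[of j i] by (auto simp: mult_ac)
next
  fix c :: "nat \<Rightarrow> complex" assume "\<exists>i<n. c i \<noteq> 0"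
  then obtain k where k: "k < n" "c k \<noteq> 0" by blast
  define q where "q = Re (sesquilinear_form n K (\<lambda>i. complex_of_real (s i) * c i))"
  have "sesquilinear_form n ?A c = (\<Sum>i<n. \<Sum>j<n. (if j = i then cnj (c i) * c i else 0) +
      complex_of_real \<epsilon> * (cnj (complex_of_real (s i) * c i) * K i j * (complex_of_real (s j) * c j)))"
    unfolding sesquilinear_form_def by (intro sum.cong) (auto simp: algebra_simps)
  also have "\<dots> = (\<Sum>i<n. cnj (c i) * c i) +
      complex_of_real \<epsilon> * sesquilinear_form n K (\<lambda>i. complex_of_real (s i) * c i)"
    by (simp add: sum.distrib sum_distrib_left sesquilinear_form_def)
  finally have form: "Re (sesquilinear_form n ?A c) = (\<Sum>i<n. (cmod (c i))\<^sup>2) + \<epsilon> * q"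
    by (simp add: q_def cmod_def power2_eq_square)
  have pos: "0 < (\<Sum>i<n. r i * (cmod (c i))\<^sup>2)" if "\<And>i. i < n \<Longrightarrow> 0 < r i" for r
    using that k by (intro sum_pos2[of _ k]) (auto simp: less_imp_le)
  from \<epsilon> show "0 < Re (sesquilinear_form n ?A c)"
  proof
    assume "\<epsilon> = 1"
    then show ?thesis using form pos[of "\<lambda>_. 1"] bounds(1) by (simp add: q_def add_pos_nonneg)
  next
    assume \<epsilon>: "\<epsilon> = - 1 \<and> (\<forall>i<n. (s i)\<^sup>2 < 1)"
    have "q \<le> (\<Sum>i<n. (s i)\<^sup>2 * (cmod (c i))\<^sup>2)"
      using bounds(2)[of "\<lambda>i. complex_of_real (s i) * c i"]
      by (simp add: q_def norm_mult power_mult_distrib)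
    moreover have "0 < (\<Sum>i<n. (1 - (s i)\<^sup>2) * (cmod (c i))\<^sup>2)"
      using \<epsilon> by (intro pos) auto
    ultimately show ?thesis
      using \<epsilon> form by (simp add: left_diff_distrib sum_subtractf)
  qed
qed

text \<open>A common sign of the \<open>b i\<close> lets the weights be shared symmetrically between
  rows and columns, which keeps the matrix Hermitian. Its diagonal involves only the zeroth Fourier
  coefficient, the integral of \<open>f\<close>.\<close>

lemma determinantal_product_le:
  fixes b :: "nat \<Rightarrow> real"
  assumes f: "f \<in> borel_measurable borel" "\<And>t. f t \<in> {0..1}"
    and process: "determinantal_process M (toeplitz_kernel f) X"
    and b: "(\<forall>i. 0 \<le> b i) \<or> (\<forall>i. - 1 < b i \<and> b i \<le> 0)"
  shows "(LINT \<omega>|M. (\<Prod>i<n. 1 + b i * occupation X (int i) \<omega>)) \<le>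
    (\<Prod>i<n. 1 + b i * circle_integral f)"
proof -
  \<comment> \<open>In the case \<open>- 1\<close> the second alternative for \<open>b\<close> must
    hold, and its bound \<open>- 1 < b i\<close> becomes \<open>(s i)\<^sup>2 < 1\<close>.\<close>
  define \<epsilon> :: real where "\<epsilon> = (if \<forall>i. 0 \<le> b i then 1 else - 1)"
  define s where "s i = sqrt \<bar>b i\<bar>" for i
  let ?K = "\<lambda>i j. toeplitz_kernel f (int i) (int j)"
  let ?A = "\<lambda>i j. (if i = j then 1 else 0) + complex_of_real (\<epsilon> * s i) * ?K i j * complex_of_real (s j)"
  have bs: "\<epsilon> * s i * s i = b i" for i
  proof (cases "\<forall>i. 0 \<le> b i")
    case True
    then have "0 \<le> b i" by blast
    then show ?thesis using True by (simp add: \<epsilon>_def s_def)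
  next
    case False
    then have "b i \<le> 0" using b by blast
    then show ?thesis using False by (simp add: \<epsilon>_def s_def)
  qed
  have "posdef n ?A"
  proof (rule posdef_identity_plus_scaled)
    show "?K j i = cnj (?K i j)" for i j
      using fourier_coeff_minus[of f "int i - int j"] by (simp add: toeplitz_kernel_def)
    show "\<epsilon> = 1 \<or> \<epsilon> = - 1 \<and> (\<forall>i<n. (s i)\<^sup>2 < 1)"
      using b by (auto simp: \<epsilon>_def s_def)
  qed (use sesquilinear_form_toeplitz_bounds[OF f] in auto)
  then obtain r where r: "Determinant.det (Matrix.mat n n (\<lambda>(i, j). ?A i j)) = complex_of_real r"
      "r \<le> (\<Prod>i<n. Re (?A i i))"
    using hadamard_inequality by blast
  have "complex_of_real (LINT \<omega>|M. (\<Prod>i<n. 1 + b i * occupation X (int i) \<omega>)) =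
      Determinant.det (Matrix.mat n n (\<lambda>(i, j). ?A i j))"
    \<comment> \<open>The row weights are \<open>\<epsilon> * s i\<close> and the column weights
      \<open>s j\<close>; by \<open>bs\<close> they multiply to \<open>b i\<close> on matching
      indices.\<close>
    by (rule determinantal_expectation[OF process, where d = "\<lambda>_. 1", unfolded of_real_1])
       (simp_all only: bs flip: of_real_mult, simp)
  moreover have "Re (?A i i) = 1 + b i * circle_integral f" for i
  proof -
    have "?A i i = complex_of_real (1 + \<epsilon> * s i * s i * circle_integral f)"
      by (simp add: toeplitz_kernel_def fourier_coeff_0 mult_ac)
    then show ?thesis by (simp only: bs Re_complex_of_real)
  qed
  ultimately show ?thesis using r by (simp flip: of_real_mult)
qed

text \<open>An occupation \<open>x\<close> is 0 or 1, so
  \<open>exp (y * x) = 1 + (exp y - 1) * x\<close> and the exponential of the sum is a product. The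
  sign of \<open>exp y - 1\<close> is that of \<open>y\<close>, and it always exceeds -1.\<close>

lemma determinantal_exp_moment:
  fixes y :: "nat \<Rightarrow> real"
  assumes f: "f \<in> borel_measurable borel" "\<And>t. f t \<in> {0..1}"
    and \<sigma>: "\<sigma> = circle_integral f" "0 \<le> \<sigma>" "\<sigma> \<le> 1"
    and process: "determinantal_process M (toeplitz_kernel f) X"
    and y: "(\<forall>i. 0 \<le> y i) \<or> (\<forall>i. y i \<le> 0)"
  shows "integrable M (\<lambda>\<omega>. exp (\<Sum>i<n. y i * (occupation X (int i) \<omega> - \<sigma>)))" (is ?I)
    and "(LINT \<omega>|M. exp (\<Sum>i<n. y i * (occupation X (int i) \<omega> - \<sigma>))) \<le> exp (\<Sum>i<n. (y i)\<^sup>2 / 8)"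
      (is ?B)
proof -
  let ?p = "\<lambda>\<omega>. \<Prod>i<n. 1 + (exp (y i) - 1) * occupation X (int i) \<omega>"
  have eq: "exp (\<Sum>i<n. y i * (occupation X (int i) \<omega> - \<sigma>)) = (\<Prod>i<n. exp (- y i * \<sigma>)) * ?p \<omega>" for \<omega>
    unfolding prod.distrib[symmetric] exp_sum[OF finite_lessThan]
    by (intro prod.cong)
       (auto simp: occupation_def indicator_def algebra_simps exp_diff exp_minus field_simps)
  show ?I
    unfolding eq using determinantal_product_integrable[OF process, of "\<lambda>_. 1"] by simp
  have "(\<forall>i. 0 \<le> exp (y i) - 1) \<or> (\<forall>i. - 1 < exp (y i) - 1 \<and> exp (y i) - 1 \<le> 0)"
    using y by auto
  from determinantal_product_le[OF f process this, of n]
  have "(LINT \<omega>|M. ?p \<omega>) \<le> (\<Prod>i<n. 1 + (exp (y i) - 1) * \<sigma>)" by (simp add: \<sigma>(1))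
  then have "(\<Prod>i<n. exp (- y i * \<sigma>)) * (LINT \<omega>|M. ?p \<omega>) \<le>
      (\<Prod>i<n. exp (- y i * \<sigma>) * (1 + (exp (y i) - 1) * \<sigma>))"
    unfolding prod.distrib by (intro mult_left_mono prod_nonneg) auto
  also have "\<dots> \<le> (\<Prod>i<n. exp ((y i)\<^sup>2 / 8))"
  proof (rule prod_mono)
    fix i
    \<comment> \<open>Written as a convex combination of 1 and \<open>exp (y i)\<close>, the factor
      is visibly nonnegative.\<close>
    have "0 \<le> (1 - \<sigma>) + exp (y i) * \<sigma>" using \<sigma>(2,3) by simp
    also have "\<dots> = 1 + (exp (y i) - 1) * \<sigma>" by (simp add: algebra_simps)
    finally have "0 \<le> 1 + (exp (y i) - 1) * \<sigma>" .
    then show "0 \<le> exp (- y i * \<sigma>) * (1 + (exp (y i) - 1) * \<sigma>) \<and>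
        exp (- y i * \<sigma>) * (1 + (exp (y i) - 1) * \<sigma>) \<le> exp ((y i)\<^sup>2 / 8)"
      using bernoulli_mgf_le[OF \<sigma>(2,3), of "y i"] by simp
  qed
  finally show ?B unfolding eq by (simp add: exp_sum)
qed

section \<open>Reduction of mixed signs to coefficients of one sign\<close>

theorem proposition3p4:
  fixes f :: "real \<Rightarrow> real" and \<sigma> :: real
    and M :: "'a measure" and X :: "'a \<Rightarrow> int set"
    and N :: nat and l :: real and a :: "nat \<Rightarrow> real"
  assumes f_periodic: "\<And>t. f (t + 1) = f t"
    and f_borel: "f \<in> borel_measurable borel"
    and f_range: "\<And>t. f t \<in> {0..1}"
    and sigma_eq: "\<sigma> = circle_integral f"
    and sigma_range: "\<sigma> \<in> {0<..<1}"
    and process: "determinantal_process M (toeplitz_kernel f) X"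
    and N_pos: "N > 0"
  shows "(LINT \<omega>|M. exp (l * (\<Sum>n<N. (occupation X (int n) \<omega> - \<sigma>) * a n)))
           \<le> exp (l\<^sup>2 * (\<Sum>n<N. (a n)\<^sup>2))"
proof -
  interpret prob_space M using process by (simp add: determinantal_process_def)
  \<comment> \<open>Positive and negative parts of the doubled coefficients; the factor 2
    compensates the halving in \<open>exp ((U + V) / 2)\<close>.\<close>
  define y z where "y n = max 0 (2 * l * a n)" and "z n = min 0 (2 * l * a n)" for n
  define U where "U w \<omega> = (\<Sum>n<N. w n * (occupation X (int n) \<omega> - \<sigma>))" for w \<omega>
  let ?R = "exp (l\<^sup>2 * (\<Sum>n<N. (a n)\<^sup>2))"
  have moment: "integrable M (\<lambda>\<omega>. exp (U w \<omega>))" "(LINT \<omega>|M. exp (U w \<omega>)) \<le> ?R"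
    if w: "(\<forall>n. 0 \<le> w n) \<or> (\<forall>n. w n \<le> 0)" and le: "\<And>n. (w n)\<^sup>2 \<le> (2 * l * a n)\<^sup>2" for w
  proof -
    note m = determinantal_exp_moment[OF f_borel f_range sigma_eq _ _ process w, of N]
    show "integrable M (\<lambda>\<omega>. exp (U w \<omega>))" unfolding U_def using m(1) sigma_range by simp
    \<comment> \<open>The doubled coefficients give \<open>4 / 8 = 1 / 2\<close> of the right-hand
      side, so a factor 2 is to spare.\<close>
    have "(w n)\<^sup>2 / 8 \<le> l\<^sup>2 * (a n)\<^sup>2" for n
    proof -
      have "(w n)\<^sup>2 \<le> 4 * (l\<^sup>2 * (a n)\<^sup>2)" using le[of n] by (simp add: power_mult_distrib)
      moreover have "0 \<le> l\<^sup>2 * (a n)\<^sup>2" by simp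
      ultimately show ?thesis by linarith
    qed
    then have "exp (\<Sum>n<N. (w n)\<^sup>2 / 8) \<le> ?R"
      by (simp add: sum_distrib_left sum_mono)
    then show "(LINT \<omega>|M. exp (U w \<omega>)) \<le> ?R"
      unfolding U_def using m(2) sigma_range by (auto intro: order.trans simp del: exp_le_cancel_iff)
  qed
  have y: "(\<forall>n. 0 \<le> y n) \<or> (\<forall>n. y n \<le> 0)" "\<And>n. (y n)\<^sup>2 \<le> (2 * l * a n)\<^sup>2"
    by (auto simp: y_def max_def)
  have z: "(\<forall>n. 0 \<le> z n) \<or> (\<forall>n. z n \<le> 0)" "\<And>n. (z n)\<^sup>2 \<le> (2 * l * a n)\<^sup>2"
    by (auto simp: z_def min_def)
  have "exp (l * (\<Sum>n<N. (occupation X (int n) \<omega> - \<sigma>) * a n)) \<le> (exp (U y \<omega>) + exp (U z \<omega>)) / 2" for \<omega>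
  proof -
    have "y n + z n = 2 * l * a n" for n by (simp add: y_def z_def max_def min_def)
    then have "U y \<omega> + U z \<omega> = 2 * (l * (\<Sum>n<N. (occupation X (int n) \<omega> - \<sigma>) * a n))"
      unfolding U_def sum.distrib[symmetric] distrib_right[symmetric]
      by (simp add: sum_distrib_left mult_ac)
    then have "exp (l * (\<Sum>n<N. (occupation X (int n) \<omega> - \<sigma>) * a n)) = exp (U y \<omega> / 2) * exp (U z \<omega> / 2)"
      by (simp flip: exp_add add_divide_distrib)
    \<comment> \<open>The inequality of arithmetic and geometric means, which separates the two
      parts without any independence.\<close>
    also have "\<dots> \<le> ((exp (U y \<omega> / 2))\<^sup>2 + (exp (U z \<omega> / 2))\<^sup>2) / 2"
      using sum_squares_bound[of "exp (U y \<omega> / 2)" "exp (U z \<omega> / 2)"] by simp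
    finally show ?thesis by (simp flip: exp_double)
  qed
  then have "(LINT \<omega>|M. exp (l * (\<Sum>n<N. (occupation X (int n) \<omega> - \<sigma>) * a n))) \<le>
      (LINT \<omega>|M. (exp (U y \<omega>) + exp (U z \<omega>)) / 2)"
    using moment(1)[OF y] moment(1)[OF z] by (intro integral_mono_AE') auto
  also have "\<dots> \<le> ?R"
    using moment[OF y] moment[OF z] by simp
  finally show ?thesis .
qed
end
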